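(* Let $(X,d)$ be a metric space, let $T:X\to X$ be a self-mapping, let $\varphi:X\to[0,\infty)$ be a given function, and let $\rho:=\inf\{d(Tx,x): x\in X,\ x\neq Tx\}$. Let $x_0\in X$ and suppose that $T$ is a type $1$ $\varphi_{x_0}$-contraction with the point $x_0$ and the function $\varphi$. If $\varphi(x_0)=0$ and $\varphi(x)\leq d(Tx,x)$ for all $x\in C_{x_0,\rho}$, then the circle $C_{x_0,\rho}$ is a $\varphi$-fixed circle of $T$.
   Context: Notation: $Fix(T)=\{x\in X: Tx=x\}$, $Z_\varphi=\{x\in X:\varphi(x)=0\}$, and $C_{x_0,r}=\{x\in X: d(x,x_0)=r\}$. A circle $C_{x_0,r}$ is a $\varphi$-fixed circle of $T$ if and only if $C_{x_0,r}\subseteq Fix(T)\cap Z_\varphi$. $T$ is a type $1$ $\varphi_{x_0}$-contraction if there is some $k\in(0,1)$ such that, for all $x\in X$, $d(Tx,x)>0$ implies $\max\{d(x,Tx),\varphi(Tx),\varphi(x)\}\leq k\max\{d(x,x_0),\varphi(x),\varphi(x_0)\}$. *)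

theory Defs
  imports "HOL-Analysis.Elementary_Metric_Spaces"
begin

definition Fix :: "('a \<Rightarrow> 'a) \<Rightarrow> 'a set" where
  "Fix T = {x. T x = x}"

definition zero_set :: "('a \<Rightarrow> real) \<Rightarrow> 'a set" where
  "zero_set \<phi> = {x. \<phi> x = 0}"

(* The circle of centre x0 and radius r is the library's sphere x0 r. *)
definition phi_fixed_circle ::
    "('a::metric_space \<Rightarrow> real) \<Rightarrow> ('a \<Rightarrow> 'a) \<Rightarrow> 'a \<Rightarrow> real \<Rightarrow> bool" where
  "phi_fixed_circle \<phi> T x0 r \<longleftrightarrow> sphere x0 r \<subseteq> Fix T \<inter> zero_set \<phi>"

definition type1_phi_contraction ::
    "('a::metric_space \<Rightarrow> real) \<Rightarrow> ('a \<Rightarrow> 'a) \<Rightarrow> 'a \<Rightarrow> bool" where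
  "type1_phi_contraction \<phi> T x0 \<longleftrightarrow>
     (\<exists>k. 0 < k \<and> k < 1 \<and>
       (\<forall>x. dist (T x) x > 0 \<longrightarrow>
          Max {dist x (T x), \<phi> (T x), \<phi> x} \<le> k * Max {dist x x0, \<phi> x, \<phi> x0}))"

(* The set is bounded below by 0, so this is the genuine infimum whenever T is not the
   identity. For the identity the set is empty and the value is an unspecified real. *)
definition min_displacement :: "('a::metric_space \<Rightarrow> 'a) \<Rightarrow> real" where
  "min_displacement T = Inf {dist (T x) x | x. x \<noteq> T x}"

end

theory Submission
  imports Defs
begin

text \<open>If a point \<open>x\<close> of the circle were moved by \<open>T\<close>, its
  displacement would be at least \<rho>, its distance to \<open>x0\<close>. With the bound on \<phi>
  and \<open>\<phi> x0 = 0\<close>, the displacement then dominates the whole right-hand maximum of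
  the contraction, so it is at most \<open>k < 1\<close> times itself, which is absurd for a
  positive number. Hence \<open>x\<close> is fixed, and the bound on \<phi> forces
  \<open>\<phi> x = 0\<close>.\<close>

lemma min_displacement_le:
  assumes "x \<noteq> T x"
  shows "min_displacement T \<le> dist (T x) x"
  unfolding min_displacement_def
proof (rule cInf_lower)
  show "bdd_below {dist (T x) x |x. x \<noteq> T x}"
    by (rule bdd_belowI[of _ 0]) auto
qed (use assms in auto)

theorem theorem2p1:
  fixes T :: "'a::metric_space \<Rightarrow> 'a" and \<phi> :: "'a \<Rightarrow> real" and x0 :: 'a and \<rho> :: real
  assumes phi_nonneg: "\<And>x. 0 \<le> \<phi> x"
    and rho: "\<rho> = min_displacement T"
    and contr: "type1_phi_contraction \<phi> T x0"
    and phi_x0: "\<phi> x0 = 0"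
    and phi_le: "\<And>x. x \<in> sphere x0 \<rho> \<Longrightarrow> \<phi> x \<le> dist (T x) x"
  shows "phi_fixed_circle \<phi> T x0 \<rho>"
  unfolding phi_fixed_circle_def
proof
  fix x assume x: "x \<in> sphere x0 \<rho>"
  have "T x = x"
  proof (rule ccontr)
    assume neq: "T x \<noteq> x"
    then have pos: "dist (T x) x > 0"
      by simp
    obtain k where k: "0 < k" "k < 1"
      and le: "Max {dist x (T x), \<phi> (T x), \<phi> x} \<le> k * Max {dist x x0, \<phi> x, \<phi> x0}"
      using contr pos unfolding type1_phi_contraction_def by blast
    \<comment> \<open>The infimum is used only here, at a moved point, so its unspecified value when
      \<open>T\<close> is the identity does no harm.\<close>
    have "dist x x0 \<le> dist (T x) x"
      using x neq min_displacement_le[of x T] rho by (simp add: dist_commute)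
    then have "Max {dist x x0, \<phi> x, \<phi> x0} \<le> dist (T x) x"
      using phi_le[OF x] phi_x0 by simp
    then have "k * Max {dist x x0, \<phi> x, \<phi> x0} \<le> k * dist (T x) x"
      using k(1) by (simp add: mult_left_mono)
    also have "\<dots> < dist (T x) x"
      using k(2) pos by simp
    \<comment> \<open>The left-hand maximum in \<open>le\<close> contains
      \<open>dist x (T x)\<close>, which closes the cycle.\<close>
    finally show False
      using le by (simp add: dist_commute)
  qed
  \<comment> \<open>At a fixed point the bound \<open>phi_le\<close> reads
    \<open>\<phi> x \<le> 0\<close>.\<close>
  moreover from this have "\<phi> x = 0"
    using phi_le[OF x] phi_nonneg[of x] by simp
  ultimately show "x \<in> Fix T \<inter> zero_set \<phi>"
    by (simp add: Fix_def zero_set_def)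
qed

end
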